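(* Let $A$ be an associative algebra, $M$ an $A$-bimodule, $H$ a Hochschild $2$-cocycle of $A$ with coefficients in $M$, and let $T:M\to A$ be an $H$-twisted Rota-Baxter operator satisfying $\mathcal Z^1_T(M,A)=d_T(\mathrm{Nij}(T))$. Then any formal one-parameter deformation $T_t$ of $T$ is equivalent to the undeformed one $T_t'=T$.
   Context: All vector spaces, linear maps and tensor products are over a field $\mathbb K$ of characteristic $0$. An $A$-bimodule is a vector space $M$ with bilinear left and right actions $a\cdot u$, $u\cdot a$ satisfying $(ab)\cdot u=a\cdot(b\cdot u)$, $(a\cdot u)\cdot b=a\cdot(u\cdot b)$, $(u\cdot a)\cdot b=u\cdot(ab)$. A Hochschild $2$-cocycle is a bilinear map $H:A^{\otimes 2}\to M$ with $a\cdot H(b,c)-H(ab,c)+H(a,bc)-H(a,b)\cdot c=0$. A linear map $T:M\to A$ is an $H$-twisted Rota-Baxter operator if $T(u)T(v)=T(u\cdot T(v)+T(u)\cdot v+H(Tu,Tv))$ for all $u,v\in M$. For $a\in A$ and $f\in\mathrm{Hom}(M,A)$, the differential $d_T$ of the cohomology complex of $T$ is $$d_T(a)(u)=T(u)a-aT(u)-T(u\cdot a)+T(a\cdot u)-T(H(Tu,a))+T(H(a,Tu)),$$ $$d_T(f)(u,v)=T(f(u)\cdot v+u\cdot f(v))+f(T(u)\cdot v+u\cdot T(v))-T(u)f(v)-f(u)T(v)+T\big(H(Tu,f(v))+H(f(u),Tv)\big)+f(H(Tu,Tv)),$$ and $\mathcal Z^1_T(M,A)=\{f\in\mathrm{Hom}(M,A):d_Tf=0\}$.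 Nijenhuis elements. For $a\in A$, $u\in M$ put $l_T(u,a)=T(u)a-T(u\cdot a+H(Tu,a))$, $r_T(a,u)=aT(u)-T(a\cdot u+H(a,Tu))$ and $\psi_a(u)=a\cdot u-u\cdot a+H(a,Tu)-H(Tu,a)$. An element $a\in A$ is a Nijenhuis element associated to $T$ if for all $b,c\in A$, $u\in M$: (i) $a\,(l_T(u,a)-r_T(a,u))-(l_T(u,a)-r_T(a,u))\,a=0$; (ii) $(ab-ba)(ac-ca)=0$; (iii) $\psi_a(b\cdot u)=(ab-ba)\cdot u+b\cdot\psi_a(u)$ and $(ab-ba)\cdot\psi_a(u)=0$; (iv) $\psi_a(u\cdot b)=u\cdot(ab-ba)+\psi_a(u)\cdot b$ and $\psi_a(u)\cdot(ab-ba)=0$; (v) $\psi_a(H(b,c))=H(ab-ba,c)+H(b,ac-ca)$ and $H(ab-ba,ac-ca)=0$. $\mathrm{Nij}(T)\subset A$ is the set of all Nijenhuis elements. The product of $A$, the actions on $M$ and $H$ extend ($\mathbb K[[t]]$-bilinearly) to $A[[t]]$, $M[[t]]$. A formal one-parameter deformation of $T$ is a formal sum $T_t=\sum_{i\ge0}t^iT_i\in\mathrm{Hom}(M,A)[[t]]$ with $T_0=T$ such that $T_t:M[[t]]\to A[[t]]$ is an $H$-twisted Rota-Baxter operator. A morphism of $H$-twisted Rota-Baxter operators from $S$ to $S'$ is a pair $(\phi,\psi)$ of an algebra morphism $\phi$ of the algebra and a linear map $\psi$ of the bimodule with $\psi(a\cdot u)=\phi(a)\cdot\psi(u)$, $\psi(u\cdot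 a)=\psi(u)\cdot\phi(a)$, $\psi\circ H=H\circ(\phi\otimes\phi)$, $\phi\circ S=S'\circ\psi$ (here over $\mathbb K[[t]]$, for $A[[t]]$ and $M[[t]]$). Two formal deformations $T_t$, $T'_t$ of $T$ are equivalent if there exist $a\in A$ and linear maps $\phi_i\in\mathrm{Hom}(A,A)$, $\psi_i\in\mathrm{Hom}(M,M)$, $i\ge2$, such that $$\phi_t=\mathrm{id}_A+t(\mathrm{ad}^l_a-\mathrm{ad}^r_a)+\sum_{i\ge2}t^i\phi_i,\qquad \psi_t=\mathrm{id}_M+t\psi_a+\sum_{i\ge2}t^i\psi_i$$ is a morphism of $H$-twisted Rota-Baxter operators from $T_t$ to $T'_t$, where $\mathrm{ad}^l_a(b)=ab$, $\mathrm{ad}^r_a(b)=ba$. *)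

theory Defs
  imports "HOL-Computational_Algebra.Formal_Power_Series"
begin

text \<open>
  The product of the algebra is the multiplication of the type class \<open>ring\<close>
  (associative, not necessarily unital). The record collects the remaining data: scalar
  multiplications, left and right action, and the 2-cochain \<open>H\<close>. The ground ring is only
  required to be commutative, because every notion is used both over the field and over the ring
  of formal power series.
\<close>

record ('k, 'a, 'm) twist_data =
  scaleA :: "'k \<Rightarrow> 'a \<Rightarrow> 'a"
  scaleM :: "'k \<Rightarrow> 'm \<Rightarrow> 'm"
  lact :: "'a \<Rightarrow> 'm \<Rightarrow> 'm"  (infixl \<open>\<rhd>\<index>\<close> 70)
  ract :: "'m \<Rightarrow> 'a \<Rightarrow> 'm"  (infixl \<open>\<lhd>\<index>\<close> 70)
  cochain :: "'a \<Rightarrow> 'a \<Rightarrow> 'm"  (\<open>H\<index>\<close>)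

definition bilinear_map ::
  "('k::comm_ring_1 \<Rightarrow> 'x::ab_group_add \<Rightarrow> 'x) \<Rightarrow> ('k \<Rightarrow> 'y::ab_group_add \<Rightarrow> 'y) \<Rightarrow>
   ('k \<Rightarrow> 'z::ab_group_add \<Rightarrow> 'z) \<Rightarrow> ('x \<Rightarrow> 'y \<Rightarrow> 'z) \<Rightarrow> bool"
  where "bilinear_map s1 s2 s3 B \<longleftrightarrow>
    (\<forall>x. module_hom s2 s3 (\<lambda>y. B x y)) \<and> (\<forall>y. module_hom s1 s3 (\<lambda>x. B x y))"

context
  fixes D :: "('k::comm_ring_1, 'a::ring, 'm::ab_group_add) twist_data" (structure)
begin

definition assoc_algebra :: bool
  where "assoc_algebra \<longleftrightarrow>
    module (scaleA D) \<and> bilinear_map (scaleA D) (scaleA D) (scaleA D) (*)"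

definition bimodule :: bool
  where "bimodule \<longleftrightarrow>
    module (scaleM D) \<and>
    bilinear_map (scaleA D) (scaleM D) (scaleM D) (lact D) \<and>
    bilinear_map (scaleM D) (scaleA D) (scaleM D) (ract D) \<and>
    (\<forall>a b u. (a * b) \<rhd> u = a \<rhd> (b \<rhd> u)) \<and>
    (\<forall>a b u. (a \<rhd> u) \<lhd> b = a \<rhd> (u \<lhd> b)) \<and>
    (\<forall>a b u. (u \<lhd> a) \<lhd> b = u \<lhd> (a * b))"

definition hochschild_2cocycle :: bool
  where "hochschild_2cocycle \<longleftrightarrow>
    bilinear_map (scaleA D) (scaleA D) (scaleM D) (cochain D) \<and>
    (\<forall>a b c. a \<rhd> H b c - H (a * b) c + H a (b * c) - H a b \<lhd> c = 0)"

definition twisted_rota_baxter :: "('m \<Rightarrow> 'a) \<Rightarrow> bool"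
  where "twisted_rota_baxter T \<longleftrightarrow>
    module_hom (scaleM D) (scaleA D) T \<and>
    (\<forall>u v. T u * T v = T (u \<lhd> T v + T u \<rhd> v + H (T u) (T v)))"

definition rb_morphism ::
  "('m \<Rightarrow> 'a) \<Rightarrow> ('m \<Rightarrow> 'a) \<Rightarrow> ('a \<Rightarrow> 'a) \<Rightarrow> ('m \<Rightarrow> 'm) \<Rightarrow> bool"
  where "rb_morphism S S' \<phi> \<psi> \<longleftrightarrow>
    twisted_rota_baxter S \<and> twisted_rota_baxter S' \<and>
    module_hom (scaleA D) (scaleA D) \<phi> \<and> (\<forall>a b. \<phi> (a * b) = \<phi> a * \<phi> b) \<and>
    module_hom (scaleM D) (scaleM D) \<psi> \<and>
    (\<forall>a u. \<psi> (a \<rhd> u) = \<phi> a \<rhd> \<psi> u) \<and>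
    (\<forall>a u. \<psi> (u \<lhd> a) = \<psi> u \<lhd> \<phi> a) \<and>
    (\<forall>a b. \<psi> (H a b) = H (\<phi> a) (\<phi> b)) \<and>
    (\<forall>u. \<phi> (S u) = S' (\<psi> u))"

definition d0 :: "('m \<Rightarrow> 'a) \<Rightarrow> 'a \<Rightarrow> 'm \<Rightarrow> 'a"
  where "d0 T a u =
    T u * a - a * T u - T (u \<lhd> a) + T (a \<rhd> u) - T (H (T u) a) + T (H a (T u))"

definition d1 :: "('m \<Rightarrow> 'a) \<Rightarrow> ('m \<Rightarrow> 'a) \<Rightarrow> 'm \<Rightarrow> 'm \<Rightarrow> 'a"
  where "d1 T f u v =
    T (f u \<rhd> v + u \<lhd> f v) + f (T u \<rhd> v + u \<lhd> T v) - T u * f v - f u * T v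
    + T (H (T u) (f v) + H (f u) (T v)) + f (H (T u) (T v))"

definition Z1 :: "('m \<Rightarrow> 'a) \<Rightarrow> ('m \<Rightarrow> 'a) set"
  where "Z1 T = {f. module_hom (scaleM D) (scaleA D) f \<and> (\<forall>u v. d1 T f u v = 0)}"

definition lT :: "('m \<Rightarrow> 'a) \<Rightarrow> 'm \<Rightarrow> 'a \<Rightarrow> 'a"
  where "lT T u a = T u * a - T (u \<lhd> a + H (T u) a)"

definition rT :: "('m \<Rightarrow> 'a) \<Rightarrow> 'a \<Rightarrow> 'm \<Rightarrow> 'a"
  where "rT T a u = a * T u - T (a \<rhd> u + H a (T u))"

definition psi :: "('m \<Rightarrow> 'a) \<Rightarrow> 'a \<Rightarrow> 'm \<Rightarrow> 'm"
  where "psi T a u = a \<rhd> u - u \<lhd> a + H a (T u) - H (T u) a"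

definition nijenhuis :: "('m \<Rightarrow> 'a) \<Rightarrow> 'a \<Rightarrow> bool"
  where "nijenhuis T a \<longleftrightarrow>
    (\<forall>u. a * (lT T u a - rT T a u) - (lT T u a - rT T a u) * a = 0) \<and>
    (\<forall>b c. (a * b - b * a) * (a * c - c * a) = 0) \<and>
    (\<forall>b u. psi T a (b \<rhd> u) = (a * b - b * a) \<rhd> u + b \<rhd> psi T a u \<and>
           (a * b - b * a) \<rhd> psi T a u = 0) \<and>
    (\<forall>b u. psi T a (u \<lhd> b) = u \<lhd> (a * b - b * a) + psi T a u \<lhd> b \<and>
           psi T a u \<lhd> (a * b - b * a) = 0) \<and>
    (\<forall>b c. psi T a (H b c) = H (a * b - b * a) c + H b (a * c - c * a) \<and>
           H (a * b - b * a) (a * c - c * a) = 0)"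

definition Nij :: "('m \<Rightarrow> 'a) \<Rightarrow> 'a set"
  where "Nij T = {a. nijenhuis T a}"

end

text \<open>
  \<open>\<bbbK>[[t]]\<close>, \<open>A[[t]]\<close> and \<open>M[[t]]\<close> are the types \<open>'k fps\<close>, \<open>'a fps\<close> and \<open>'m fps\<close>; the product of
  \<open>A[[t]]\<close> is the library's Cauchy product, and the other bilinear operations extend by the same
  formula. A formal sum of linear maps \<open>f\<^sub>i\<close> is given by the sequence of its coefficients and acts
  on power series by the Cauchy rule.
\<close>

definition fps_bilin ::
  "('x \<Rightarrow> 'y \<Rightarrow> 'z::comm_monoid_add) \<Rightarrow> 'x fps \<Rightarrow> 'y fps \<Rightarrow> 'z fps"
  where "fps_bilin B f g = Abs_fps (\<lambda>n. \<Sum>i=0..n. B (fps_nth f i) (fps_nth g (n - i)))"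

definition fps_maps ::
  "(nat \<Rightarrow> 'x \<Rightarrow> 'y::comm_monoid_add) \<Rightarrow> 'x fps \<Rightarrow> 'y fps"
  where "fps_maps F x = Abs_fps (\<lambda>n. \<Sum>i=0..n. F i (fps_nth x (n - i)))"

definition fps_data ::
  "('k::comm_ring_1, 'a::ring, 'm::ab_group_add) twist_data \<Rightarrow>
   ('k fps, 'a fps, 'm fps) twist_data"
  where "fps_data D =
    \<lparr>scaleA = fps_bilin (scaleA D), scaleM = fps_bilin (scaleM D),
     lact = fps_bilin (lact D), ract = fps_bilin (ract D), cochain = fps_bilin (cochain D)\<rparr>"

definition formal_deformation ::
  "('k::comm_ring_1, 'a::ring, 'm::ab_group_add) twist_data \<Rightarrow>
   ('m \<Rightarrow> 'a) \<Rightarrow> (nat \<Rightarrow> 'm \<Rightarrow> 'a) \<Rightarrow> bool"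
  where "formal_deformation D T Tt \<longleftrightarrow>
    (\<forall>i. module_hom (scaleM D) (scaleA D) (Tt i)) \<and> Tt 0 = T \<and>
    twisted_rota_baxter (fps_data D) (fps_maps Tt)"

definition undeformed :: "('m \<Rightarrow> 'a::zero) \<Rightarrow> nat \<Rightarrow> 'm \<Rightarrow> 'a"
  where "undeformed T i = (if i = 0 then T else (\<lambda>u. 0))"

definition equivalent_deformations ::
  "('k::comm_ring_1, 'a::ring, 'm::ab_group_add) twist_data \<Rightarrow>
   ('m \<Rightarrow> 'a) \<Rightarrow> (nat \<Rightarrow> 'm \<Rightarrow> 'a) \<Rightarrow> (nat \<Rightarrow> 'm \<Rightarrow> 'a) \<Rightarrow> bool"
  where "equivalent_deformations D T Tt Tt' \<longleftrightarrow>
    formal_deformation D T Tt \<and> formal_deformation D T Tt' \<and>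
    (\<exists>a \<phi> \<psi>.
       \<phi> 0 = id \<and> \<phi> 1 = (\<lambda>b. a * b - b * a) \<and>
       (\<forall>i\<ge>2. module_hom (scaleA D) (scaleA D) (\<phi> i)) \<and>
       \<psi> 0 = id \<and> \<psi> 1 = psi D T a \<and>
       (\<forall>i\<ge>2. module_hom (scaleM D) (scaleM D) (\<psi> i)) \<and>
       rb_morphism (fps_data D) (fps_maps Tt) (fps_maps Tt') (fps_maps \<phi>) (fps_maps \<psi>))"

end

theory Submission
  imports Defs
begin

text \<open>
  If \<open>S = T + t\<^sup>n S\<^sub>n + \<dots>\<close> is a deformation, the coefficient of \<open>t\<^sup>n\<close> in the Rota-Baxter
  identity says that \<open>S\<^sub>n\<close> is a cocycle, so \<open>S\<^sub>n = d\<^sub>T(a)\<close> with \<open>a\<close> a Nijenhuis element. The Nijenhuis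
  conditions ensure that \<open>\<phi> = id + t\<^sup>n (ad\<^sup>l\<^sub>a - ad\<^sup>r\<^sub>a)\<close> and \<open>\<psi> = id + t\<^sup>n \<psi>\<^sub>a\<close> respect all
  the structure, without any higher correction terms; hence \<open>\<phi> S \<psi>\<^sup>-\<^sup>1\<close> is again a deformation, and
  its \<open>t\<^sup>n\<close> coefficient is \<open>S\<^sub>n - d\<^sub>T(a) = 0\<close>. Killing the coefficients one after another gives a
  sequence of composite morphisms that converges \<open>t\<close>-adically; only the step \<open>n = 1\<close> contributes
  to their linear coefficient.
\<close>

section \<open>Cauchy products, shifts and formal sums of maps\<close>

text \<open>Multiplication by t^n. It is encoded as a shift because \<open>A\<close> need not be
  unital and \<open>M\<close> carries no product, so t^n is not an element of A[[t]] or
  M[[t]].\<close>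

definition fps_delay :: "nat \<Rightarrow> 'x fps \<Rightarrow> 'x::zero fps"
  where "fps_delay n x = Abs_fps (\<lambda>m. if m < n then 0 else fps_nth x (m - n))"

definition fps_lift :: "('x \<Rightarrow> 'y) \<Rightarrow> 'x fps \<Rightarrow> 'y fps"
  where "fps_lift f x = Abs_fps (\<lambda>m. f (fps_nth x m))"

text \<open>For additive \<open>f\<close>, the coefficients of (id + t^n f) after \<open>F\<close>.
  Composites with such maps thus stay formal sums of maps, the shape in which equivalence of
  deformations is stated.\<close>

definition perturb :: "nat \<Rightarrow> ('y \<Rightarrow> 'y) \<Rightarrow> (nat \<Rightarrow> 'x \<Rightarrow> 'y::comm_monoid_add) \<Rightarrow> nat \<Rightarrow> 'x \<Rightarrow> 'y"
  where "perturb n f F m x = F m x + (if m < n then 0 else f (F (m - n) x))"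

lemma fps_delay_nth [simp]:
  "fps_nth (fps_delay n x) m = (if m < n then 0 else fps_nth x (m - n))"
  by (simp add: fps_delay_def)

lemma fps_lift_nth [simp]: "fps_nth (fps_lift f x) m = f (fps_nth x m)"
  by (simp add: fps_lift_def)

lemma fps_bilin_nth: "fps_nth (fps_bilin B x y) n = (\<Sum>i=0..n. B (fps_nth x i) (fps_nth y (n - i)))"
  by (simp add: fps_bilin_def)

lemma fps_maps_nth: "fps_nth (fps_maps F x) n = (\<Sum>i=0..n. F i (fps_nth x (n - i)))"
  by (simp add: fps_maps_def)

lemma fps_times_bilin: "x * y = fps_bilin (*) x y" for x y :: "'a::ring fps"
  by (simp add: fps_eq_iff fps_bilin_nth fps_mult_nth)

text \<open>A formal sum acts by the Cauchy product of the evaluation pairing, so facts about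
  \<open>fps_bilin\<close> carry over to it.\<close>

lemma fps_maps_bilin: "fps_maps F x = fps_bilin (\<lambda>f. f) (Abs_fps F) x"
  by (simp add: fps_eq_iff fps_bilin_nth fps_maps_nth)

lemma fps_bilin_flip: "fps_bilin B x y = fps_bilin (\<lambda>y x. B x y) y x"
proof (rule fps_ext)
  fix n
  show "fps_nth (fps_bilin B x y) n = fps_nth (fps_bilin (\<lambda>y x. B x y) y x) n"
    unfolding fps_bilin_nth by (subst sum.atLeastAtMost_rev) simp
qed

lemma fps_bilin_nth_cong:
  assumes "\<And>i. i \<le> n \<Longrightarrow> fps_nth x i = fps_nth x' i" and "\<And>i. i \<le> n \<Longrightarrow> fps_nth y i = fps_nth y' i"
  shows "fps_nth (fps_bilin B x y) n = fps_nth (fps_bilin B x' y') n"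
  using assms by (auto simp: fps_bilin_nth intro!: sum.cong)

lemma fps_maps_nth_cong:
  assumes "\<And>i. i \<le> n \<Longrightarrow> F i = G i" and "\<And>i. i \<le> n \<Longrightarrow> fps_nth x i = fps_nth y i"
  shows "fps_nth (fps_maps F x) n = fps_nth (fps_maps G y) n"
  using assms by (auto simp: fps_maps_nth intro!: sum.cong)

lemma sum_delay:
  fixes m n :: nat
  shows "(\<Sum>i=0..m. if i < n then 0 else g (i - n) (m - i))
    = (if m < n then 0 else (\<Sum>i=0..m - n. g i (m - n - i) :: 'x::comm_monoid_add))"
proof (cases "m < n")
  case True
  then have "(\<Sum>i=0..m. if i < n then 0 else g (i - n) (m - i)) = 0"
    by (intro sum.neutral) auto
  with True show ?thesis by simp
next
  case False
  then have "n \<le> m" by simp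
  have "(\<Sum>i=0..m. if i < n then 0 else g (i - n) (m - i)) = (\<Sum>i=n..m. g (i - n) (m - i))"
    by (rule sum.mono_neutral_cong_right) auto
  then show ?thesis
    using \<open>n \<le> m\<close> by (simp add: sum.atLeastAtMost_shift_0[of n m] add.commute)
qed

lemma fps_bilin_delay_left:
  assumes "\<And>i. B 0 (fps_nth y i) = 0"
  shows "fps_bilin B (fps_delay k x) y = fps_delay k (fps_bilin B x y)"
  by (simp add: fps_eq_iff fps_bilin_nth assms if_distrib[of "\<lambda>x. B x _"] sum_delay
      [of k "\<lambda>i j. B (fps_nth x i) (fps_nth y j)"] cong: if_cong)

lemma fps_bilin_delay_right:
  assumes "\<And>i. B (fps_nth x i) 0 = 0"
  shows "fps_bilin B x (fps_delay k y) = fps_delay k (fps_bilin B x y)"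
  using fps_bilin_delay_left[of "\<lambda>y x. B x y" x k y] assms
  by (simp add: fps_bilin_flip[of B])

lemma fps_maps_delay_left:
  "fps_maps (\<lambda>m x. if m < n then 0 else F (m - n) x) x = fps_delay n (fps_maps F x)"
  by (simp add: fps_eq_iff fps_maps_nth sum_delay[of n "\<lambda>i j. F i (fps_nth x j)"])

lemma fps_maps_delay_right:
  assumes "\<And>i. F i 0 = 0"
  shows "fps_maps F (fps_delay n x) = fps_delay n (fps_maps F x)"
  unfolding fps_maps_bilin by (rule fps_bilin_delay_right) (simp add: assms)

lemma fps_maps_add:
  assumes "\<And>i. additive (F i)"
  shows "fps_maps F (x + y) = fps_maps F x + fps_maps F y"
  using assms by (simp add: fps_eq_iff fps_maps_nth additive.add sum.distrib)

text \<open>Every term strictly between the ends has a vanishing left factor. This extracts the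
  coefficient of t^n when the left series is x_0 + t^n x_n + ....\<close>

lemma fps_bilin_nth_sparse:
  assumes "\<And>y. B 0 y = 0" and "\<And>i. 0 < i \<Longrightarrow> i < n \<Longrightarrow> fps_nth x i = 0" and "0 < n"
  shows "fps_nth (fps_bilin B x y) n
    = B (fps_nth x 0) (fps_nth y n) + B (fps_nth x n) (fps_nth y 0)"
proof -
  have "fps_nth (fps_bilin B x y) n = (\<Sum>i\<in>{0,n}. B (fps_nth x i) (fps_nth y (n - i)))"
    unfolding fps_bilin_nth using assms by (intro sum.mono_neutral_right) auto
  then show ?thesis using \<open>0 < n\<close> by simp
qed

lemma fps_delay_add: "fps_delay k (x + y) = fps_delay k x + fps_delay k y"
  for x y :: "'x::comm_monoid_add fps"
  by (simp add: fps_eq_iff)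

lemma fps_delay_0 [simp]: "fps_delay k 0 = 0"
  by (simp add: fps_eq_iff)

section \<open>Biadditive maps extended to power series\<close>

locale biadditive =
  fixes B :: "'x::ab_group_add \<Rightarrow> 'y::ab_group_add \<Rightarrow> 'z::ab_group_add"
  assumes add_left: "B (x + x') y = B x y + B x' y"
    and add_right: "B x (y + y') = B x y + B x y'"
begin

sublocale left: additive "\<lambda>x. B x y" for y
  by unfold_locales (rule add_left)

sublocale right: additive "\<lambda>y. B x y" for x
  by unfold_locales (rule add_right)

lemma fps_biadditive: "biadditive (fps_bilin B)"
  by unfold_locales (simp_all add: fps_eq_iff fps_bilin_nth add_left add_right sum.distrib)

text \<open>The left side expands into B(x,y), two terms with t^n and one with t^(2n). The Leibniz
  rule merges the middle terms into h(B(x,y)); the third assumption kills the last one. Through this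
  the Nijenhuis conditions give exact compatibility, not just compatibility to first order.\<close>

lemma fps_bilin_perturb:
  assumes "additive h"
    and "\<And>x y. h (B x y) = B (f x) y + B x (g y)"
    and "\<And>x y. B (f x) (g y) = 0"
  shows "fps_bilin B (x + fps_delay n (fps_lift f x)) (y + fps_delay n (fps_lift g y))
    = fps_bilin B x y + fps_delay n (fps_lift h (fps_bilin B x y))"
proof -
  interpret h: additive h by fact
  interpret F: biadditive "fps_bilin B" by (rule fps_biadditive)
  have 1: "fps_lift h (fps_bilin B x y) = fps_bilin B (fps_lift f x) y + fps_bilin B x (fps_lift g y)"
    by (simp add: fps_eq_iff fps_bilin_nth h.sum assms(2) sum.distrib)
  have 2: "fps_bilin B (fps_lift f x) (fps_lift g y) = 0"
    by (simp add: fps_eq_iff fps_bilin_nth assms(3))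
  show ?thesis
    by (simp add: F.add_left F.add_right fps_bilin_delay_left fps_bilin_delay_right
        left.zero right.zero 1 2 fps_delay_add)
qed

end

text \<open>Separate maps cover mixed laws such as (ab)x = a(bx) for scalars, where a ring product
  meets an action.\<close>

lemma fps_bilin_assoc:
  assumes "biadditive B1" and "biadditive B3"
    and "\<And>a b c. B1 (B2 a b) c = B3 a (B4 b c)"
  shows "fps_bilin B1 (fps_bilin B2 a b) c = fps_bilin B3 a (fps_bilin B4 b c)"
proof -
  interpret B1: biadditive B1 by fact
  interpret B3: biadditive B3 by fact
  show ?thesis
    by (simp add: fps_eq_iff fps_bilin_nth B1.left.sum B3.right.sum assms(3) fps_mult_assoc_lemma
        [of "\<lambda>i j k. B3 (fps_nth a i) (B4 (fps_nth b j) (fps_nth c k))"])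
qed

section \<open>Modules and linear maps over formal power series\<close>

lemma module_biadditive:
  assumes "module s"
  shows "biadditive s"
proof -
  interpret module s by fact
  show ?thesis by unfold_locales (simp_all add: algebra_simps)
qed

lemma fps_module:
  assumes "module s"
  shows "module (fps_bilin s)"
proof -
  interpret module s by fact
  interpret B: biadditive s by (rule module_biadditive) fact
  interpret F: biadditive "fps_bilin s" by (rule B.fps_biadditive)
  show ?thesis
  proof
    show "fps_bilin s a (fps_bilin s b x) = fps_bilin s (a * b) x" for a b x
      unfolding fps_times_bilin
      by (rule fps_bilin_assoc[symmetric]) (simp_all add: B.biadditive_axioms)
    show "fps_bilin s 1 x = x" for x
      by (simp add: fps_eq_iff fps_bilin_nth if_distrib[of "\<lambda>c. s c _"] sum.delta cong: if_cong)
  qed (rule F.add_left F.add_right)+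
qed

lemma fps_maps_module_hom:
  assumes "\<And>i. module_hom s1 s2 (F i)"
  shows "module_hom (fps_bilin s1) (fps_bilin s2) (fps_maps F)"
proof -
  interpret module_hom s1 s2 "F i" for i by fact
  interpret s2: biadditive s2 by (rule module_biadditive) (rule m2.module_axioms)
  have "fps_maps F (fps_bilin s1 c x) = fps_bilin s2 c (fps_maps F x)" for c x
  proof (rule fps_ext)
    fix n
    have "fps_nth (fps_maps F (fps_bilin s1 c x)) n
      = (\<Sum>i=0..n. \<Sum>j=0..n-i. s2 (fps_nth c j) (F i (fps_nth x (n - i - j))))"
      by (simp add: fps_maps_nth fps_bilin_nth sum scale)
    \<comment> \<open>Both iterated sums run over the triangle i + j \<le> n, on which swapping the
      indices is a bijection.\<close>
    also have "\<dots> = (\<Sum>(i,j)\<in>{(i,j). i + j \<le> n}. s2 (fps_nth c j) (F i (fps_nth x (n - i - j))))"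
      by (subst sum.Sigma) (auto intro!: sum.cong)
    also have "\<dots> = (\<Sum>(j,i)\<in>{(j,i). j + i \<le> n}. s2 (fps_nth c j) (F i (fps_nth x (n - j - i))))"
      by (rule sum.reindex_bij_witness[where i="\<lambda>(a,b). (b,a)" and j="\<lambda>(a,b). (b,a)"])
        (auto simp: add.commute)
    also have "\<dots> = (\<Sum>j=0..n. \<Sum>i=0..n-j. s2 (fps_nth c j) (F i (fps_nth x (n - j - i))))"
      by (subst sum.Sigma) (auto intro!: sum.cong)
    also have "\<dots> = fps_nth (fps_bilin s2 c (fps_maps F x)) n"
      by (simp add: fps_maps_nth fps_bilin_nth s2.right.sum)
    finally show "fps_nth (fps_maps F (fps_bilin s1 c x)) n = fps_nth (fps_bilin s2 c (fps_maps F x)) n" .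
  qed
  moreover have "fps_maps F (x + y) = fps_maps F x + fps_maps F y" for x y
    by (simp add: fps_eq_iff fps_maps_nth add sum.distrib)
  ultimately show ?thesis
    by (simp add: module_hom_iff fps_module m1.module_axioms m2.module_axioms)
qed

lemma module_hom_additive: "module_hom s1 s2 f \<Longrightarrow> additive f"
  by (simp add: additive_def module_hom_iff)

lemma fps_maps_perturb:
  assumes "additive f"
  shows "fps_maps (perturb n f F) x = fps_maps F x + fps_delay n (fps_lift f (fps_maps F x))"
proof -
  interpret additive f by fact
  have "fps_maps (perturb n f F) x
      = fps_maps F x + fps_maps (\<lambda>m x. if m < n then 0 else f (F (m - n) x)) x"
    by (simp add: fps_eq_iff fps_maps_nth perturb_def sum.distrib)
  moreover have "fps_maps (\<lambda>m x. f (F m x)) x = fps_lift f (fps_maps F x)"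
    by (simp add: fps_eq_iff fps_maps_nth sum)
  ultimately show ?thesis
    by (simp add: fps_maps_delay_left[of n "\<lambda>m x. f (F m x)"])
qed

lemma undeformed_0 [simp]: "undeformed f 0 = f"
  by (simp add: undeformed_def fun_eq_iff)

text \<open>A single map counts as a formal sum concentrated in degree 0;
  \<open>undeformed id\<close> is the starting point of the automorphisms built later.\<close>

lemma fps_maps_undeformed [simp]: "fps_maps (undeformed f) x = fps_lift f x"
  by (simp add: fps_eq_iff fps_maps_nth undeformed_def if_distrib[of "\<lambda>f. f _"] sum.delta cong: if_cong)

lemma fps_lift_id [simp]: "fps_lift id x = x" "fps_lift (\<lambda>x. x) x = x"
  by (simp_all add: fps_eq_iff)

lemma bilinear_map_biadditive: "bilinear_map s1 s2 s3 B \<Longrightarrow> biadditive B"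
  by (simp add: bilinear_map_def biadditive_def module_hom_iff)

lemma fps_data_simps [simp]:
  "scaleA (fps_data D) = fps_bilin (scaleA D)" "scaleM (fps_data D) = fps_bilin (scaleM D)"
  "lact (fps_data D) = fps_bilin (lact D)" "ract (fps_data D) = fps_bilin (ract D)"
  "cochain (fps_data D) = fps_bilin (cochain D)"
  by (simp_all add: fps_data_def)

section \<open>Morphisms and transport of operators\<close>

text \<open>The part of a morphism that does not mention the operators, so that automorphisms of the
  ambient structure can be built before the target operator is known to be Rota-Baxter.\<close>

definition twist_hom ::
  "('k::comm_ring_1, 'a::ring, 'm::ab_group_add) twist_data \<Rightarrow> ('a \<Rightarrow> 'a) \<Rightarrow> ('m \<Rightarrow> 'm) \<Rightarrow> bool"
  where "twist_hom D \<phi> \<psi> \<longleftrightarrow>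
    module_hom (scaleA D) (scaleA D) \<phi> \<and> (\<forall>a b. \<phi> (a * b) = \<phi> a * \<phi> b) \<and>
    module_hom (scaleM D) (scaleM D) \<psi> \<and>
    (\<forall>a u. \<psi> (lact D a u) = lact D (\<phi> a) (\<psi> u)) \<and>
    (\<forall>a u. \<psi> (ract D u a) = ract D (\<psi> u) (\<phi> a)) \<and>
    (\<forall>a b. \<psi> (cochain D a b) = cochain D (\<phi> a) (\<phi> b))"

lemma rb_morphism_iff:
  "rb_morphism D S S' \<phi> \<psi> \<longleftrightarrow> twisted_rota_baxter D S \<and> twisted_rota_baxter D S' \<and>
    twist_hom D \<phi> \<psi> \<and> (\<forall>u. \<phi> (S u) = S' (\<psi> u))"
  by (auto simp: rb_morphism_def twist_hom_def)

lemma twist_hom_comp: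
  assumes "twist_hom D \<phi> \<psi>" and "twist_hom D \<phi>' \<psi>'"
  shows "twist_hom D (\<phi>' \<circ> \<phi>) (\<psi>' \<circ> \<psi>)"
  using assms unfolding twist_hom_def by (auto intro: module_hom_compose)

lemma rb_morphism_comp:
  assumes "rb_morphism D S S' \<phi> \<psi>" and "rb_morphism D S' S'' \<phi>' \<psi>'"
  shows "rb_morphism D S S'' (\<phi>' \<circ> \<phi>) (\<psi>' \<circ> \<psi>)"
  using assms by (auto simp: rb_morphism_iff intro: twist_hom_comp)

text \<open>By surjectivity all arguments of \<open>S'\<close> have the form
  \<open>\<psi> x\<close>, and there the identity for \<open>S'\<close> is the image under
  \<open>\<phi>\<close> of the identity for \<open>S\<close>. No explicit inverse of
  \<open>\<psi>\<close> is involved.\<close>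

lemma rb_morphism_transport:
  assumes "twisted_rota_baxter D S" and "twist_hom D \<phi> \<psi>" and "surj \<psi>"
    and "module_hom (scaleM D) (scaleA D) S'" and "\<And>u. \<phi> (S u) = S' (\<psi> u)"
  shows "rb_morphism D S S' \<phi> \<psi>"
proof -
  interpret \<psi>: module_hom "scaleM D" "scaleM D" \<psi>
    using assms(2) by (simp add: twist_hom_def)
  have hom: "\<phi> (a * b) = \<phi> a * \<phi> b" "\<psi> (lact D a u) = lact D (\<phi> a) (\<psi> u)"
    "\<psi> (ract D u a) = ract D (\<psi> u) (\<phi> a)" "\<psi> (cochain D a b) = cochain D (\<phi> a) (\<phi> b)" for a b u
    using assms(2) by (auto simp: twist_hom_def)
  have "S' u * S' v = S' (ract D u (S' v) + lact D (S' u) v + cochain D (S' u) (S' v))" for u v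
  proof -
    obtain x y where [simp]: "u = \<psi> x" "v = \<psi> y"
      using \<open>surj \<psi>\<close> by (metis surjD)
    have "S' u * S' v = \<phi> (S x * S y)"
      by (simp add: hom assms(5))
    also have "S x * S y = S (ract D x (S y) + lact D (S x) y + cochain D (S x) (S y))"
      using assms(1) by (simp add: twisted_rota_baxter_def)
    also have "\<phi> \<dots> = S' (ract D u (S' v) + lact D (S' u) v + cochain D (S' u) (S' v))"
      by (simp add: assms(5) \<psi>.add hom)
    finally show ?thesis .
  qed
  with assms show ?thesis
    by (simp add: rb_morphism_iff twisted_rota_baxter_def)
qed

section \<open>Inverting id + t^n f by recursion\<close>

text \<open>Value \<open>m\<close> refers back by \<open>Suc n\<close> places; the successor keeps
  the delay positive, which ensures termination. A delay of \<open>n > 0\<close> is obtained with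
  argument \<open>n - 1\<close>.\<close>

fun delay_rec :: "nat \<Rightarrow> (nat \<Rightarrow> 'z) \<Rightarrow> (nat \<Rightarrow> 'z \<Rightarrow> 'z) \<Rightarrow> nat \<Rightarrow> 'z"
  where "delay_rec n b c m = (if m < Suc n then b m else c m (delay_rec n b c (m - Suc n)))"

declare delay_rec.simps [simp del]

text \<open>A preimage of y is found coefficientwise: x_m = y_m for m < n, and x_m = y_m -
  f(x_(m-n)) afterwards.\<close>

lemma surj_perturb:
  fixes f :: "'x::ab_group_add \<Rightarrow> 'x"
  assumes "0 < n"
  shows "surj (\<lambda>x. x + fps_delay n (fps_lift f x))"
proof (rule surjI)
  fix y :: "'x fps"
  let ?x = "Abs_fps (delay_rec (n - 1) (fps_nth y) (\<lambda>m z. fps_nth y m - f z))"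
  show "?x + fps_delay n (fps_lift f ?x) = y"
  proof (rule fps_ext)
    fix m
    show "fps_nth (?x + fps_delay n (fps_lift f ?x)) m = fps_nth y m"
      using assms by (simp add: delay_rec.simps[of _ _ _ m])
  qed
qed

lemma module_hom_perturb:
  assumes "module_hom s2 s2 f" and "\<And>i. module_hom s1 s2 (F i)"
  shows "module_hom s1 s2 (perturb n f F i)"
proof -
  interpret F: module_hom s1 s2 "F i" by fact
  interpret module_pair s1 s2 by unfold_locales
  show ?thesis
  proof (cases "i < n")
    case True
    then have "perturb n f F i = F i" by (simp add: perturb_def fun_eq_iff)
    then show ?thesis using assms by simp
  next
    case False
    then have "perturb n f F i = (\<lambda>x. F i x + (f \<circ> F (i - n)) x)" by (simp add: perturb_def fun_eq_iff)
    then show ?thesis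
      using assms by (simp only:) (intro module_hom_add module_hom_compose)
  qed
qed

lemma module_hom_undeformed:
  assumes "module_hom s1 s2 f"
  shows "module_hom s1 s2 (undeformed f i)"
proof -
  interpret module_hom s1 s2 f by fact
  interpret module_pair s1 s2 by unfold_locales
  show ?thesis
    by (simp add: undeformed_def assms module_hom_zero)
qed

section \<open>Limits of morphisms in the t-adic topology\<close>

text \<open>The coefficient of t^n in each required identity involves only coefficients of degree at
  most n, and there the limit agrees with stage n, where the identity holds.\<close>

lemma rb_morphism_limit:
  assumes mor: "\<And>k. rb_morphism (fps_data D) (fps_maps S) (fps_maps (R k)) (fps_maps (F k)) (fps_maps (G k))"
    and F: "\<And>k i. i \<le> k \<Longrightarrow> F k i = \<phi> i" and G: "\<And>k i. i \<le> k \<Longrightarrow> G k i = \<psi> i"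
    and R: "\<And>k i. i \<le> k \<Longrightarrow> R k i = S' i"
    and S': "twisted_rota_baxter (fps_data D) (fps_maps S')"
    and \<phi>: "\<And>i. module_hom (scaleA D) (scaleA D) (\<phi> i)"
    and \<psi>: "\<And>i. module_hom (scaleM D) (scaleM D) (\<psi> i)"
  shows "rb_morphism (fps_data D) (fps_maps S) (fps_maps S') (fps_maps \<phi>) (fps_maps \<psi>)"
proof -
  have \<phi>_nth: "fps_nth (fps_maps \<phi> x) i = fps_nth (fps_maps (F n) x) i"
    and \<psi>_nth: "fps_nth (fps_maps \<psi> u) i = fps_nth (fps_maps (G n) u) i" if "i \<le> n" for x u i n
    using that by (auto intro!: fps_maps_nth_cong simp: F G)
  note bilin_cong = fps_bilin_nth_cong[OF \<phi>_nth \<phi>_nth] fps_bilin_nth_cong[OF \<phi>_nth \<psi>_nth]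
    fps_bilin_nth_cong[OF \<psi>_nth \<phi>_nth]
  have hom: "twist_hom (fps_data D) (fps_maps (F n)) (fps_maps (G n))" for n
    using mor[of n] by (simp add: rb_morphism_iff)
  have "fps_maps \<phi> (a * b) = fps_maps \<phi> a * fps_maps \<phi> b" for a b
    using hom by (auto simp: fps_eq_iff \<phi>_nth[OF order_refl] fps_times_bilin bilin_cong twist_hom_def)
  moreover have "fps_maps \<psi> (fps_bilin (lact D) a u) = fps_bilin (lact D) (fps_maps \<phi> a) (fps_maps \<psi> u)"
    and "fps_maps \<psi> (fps_bilin (ract D) u a) = fps_bilin (ract D) (fps_maps \<psi> u) (fps_maps \<phi> a)"
    and "fps_maps \<psi> (fps_bilin (cochain D) a b) = fps_bilin (cochain D) (fps_maps \<phi> a) (fps_maps \<phi> b)"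
    for a b u
    using hom by (auto simp: fps_eq_iff \<psi>_nth[OF order_refl] bilin_cong twist_hom_def)
  ultimately have "twist_hom (fps_data D) (fps_maps \<phi>) (fps_maps \<psi>)"
    using fps_maps_module_hom[OF \<phi>] fps_maps_module_hom[OF \<psi>] by (simp add: twist_hom_def)
  moreover have "fps_maps \<phi> (fps_maps S u) = fps_maps S' (fps_maps \<psi> u)" for u
  proof (rule fps_ext)
    fix n
    have "fps_nth (fps_maps \<phi> (fps_maps S u)) n = fps_nth (fps_maps (R n) (fps_maps (G n) u)) n"
      using mor[of n] by (simp add: \<phi>_nth[OF order_refl] rb_morphism_iff)
    also have "\<dots> = fps_nth (fps_maps S' (fps_maps \<psi> u)) n"
      by (rule fps_maps_nth_cong) (simp_all add: R \<psi>_nth)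
    finally show "fps_nth (fps_maps \<phi> (fps_maps S u)) n = fps_nth (fps_maps S' (fps_maps \<psi> u)) n" .
  qed
  ultimately show ?thesis
    using S' mor[of 0] by (simp add: rb_morphism_iff)
qed

section \<open>Automorphisms from Nijenhuis elements\<close>

locale hochschild_twist =
  fixes D :: "('k::comm_ring_1, 'a::ring, 'm::ab_group_add) twist_data" (structure)
  assumes assoc_algebra: "assoc_algebra D"
    and bimodule: "bimodule D"
    and hochschild_2cocycle: "hochschild_2cocycle D"
begin

sublocale mult: biadditive "(*) :: 'a \<Rightarrow> 'a \<Rightarrow> 'a"
  by unfold_locales (simp_all add: algebra_simps)

sublocale lact: biadditive "lact D"
  using bimodule by (auto simp: bimodule_def intro: bilinear_map_biadditive)

sublocale ract: biadditive "ract D"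
  using bimodule by (auto simp: bimodule_def intro: bilinear_map_biadditive)

sublocale cochain: biadditive "cochain D"
  using hochschild_2cocycle by (auto simp: hochschild_2cocycle_def intro: bilinear_map_biadditive)

sublocale A: module "scaleA D"
  using assoc_algebra by (simp add: assoc_algebra_def)

sublocale M: module "scaleM D"
  using bimodule by (simp add: bimodule_def)

lemma module_hom_commutator: "module_hom (scaleA D) (scaleA D) (\<lambda>b. a * b - b * a)"
  using assoc_algebra module_pair.module_hom_sub[of "scaleA D" "scaleA D" "(*) a" "\<lambda>b. b * a"]
  by (simp add: assoc_algebra_def bilinear_map_def module_pair_def)

lemma module_hom_psi:
  assumes "module_hom (scaleM D) (scaleA D) T"
  shows "module_hom (scaleM D) (scaleM D) (psi D T a)"
proof -
  interpret module_pair "scaleM D" "scaleM D" by unfold_locales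
  have l: "module_hom (scaleM D) (scaleM D) (\<lambda>u. a \<rhd> u)"
    and r: "module_hom (scaleM D) (scaleM D) (\<lambda>u. u \<lhd> a)"
    using bimodule by (auto simp: bimodule_def bilinear_map_def)
  have h: "module_hom (scaleM D) (scaleM D) (\<lambda>u. H a (T u))"
    and h': "module_hom (scaleM D) (scaleM D) (\<lambda>u. H (T u) a)"
    using hochschild_2cocycle module_hom_compose[OF assms]
    by (auto simp: hochschild_2cocycle_def bilinear_map_def comp_def)
  show ?thesis
    unfolding psi_def[abs_def] by (intro module_hom_sub module_hom_add l r h h')
qed

text \<open>Conditions (ii) to (v) supply the vanishing products, and (iii) to (v) the Leibniz
  rules, required by \<open>fps_bilin_perturb\<close>; for the product of \<open>A\<close> the
  Leibniz rule is that of the commutator.\<close>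

lemma twist_hom_perturb:
  assumes "module_hom (scaleM D) (scaleA D) T" and "nijenhuis D T a"
  shows "twist_hom (fps_data D)
    (\<lambda>x. x + fps_delay n (fps_lift (\<lambda>b. a * b - b * a) x))
    (\<lambda>u. u + fps_delay n (fps_lift (psi D T a) u))"
proof -
  let ?\<delta> = "\<lambda>b. a * b - b * a"
  have \<delta>: "additive ?\<delta>" and \<psi>: "additive (psi D T a)"
    using module_hom_additive module_hom_commutator module_hom_psi[OF assms(1)] by blast+
  \<comment> \<open>Linearity over power series comes from writing both maps as formal sums,
    perturbations of the constant identity.\<close>
  have "module_hom (fps_bilin (scaleA D)) (fps_bilin (scaleA D))
      (fps_maps (perturb n ?\<delta> (undeformed id)))"
    by (intro fps_maps_module_hom module_hom_perturb module_hom_undeformed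
        module_hom_commutator A.module_hom_id)
  moreover have "module_hom (fps_bilin (scaleM D)) (fps_bilin (scaleM D))
      (fps_maps (perturb n (psi D T a) (undeformed id)))"
    by (intro fps_maps_module_hom module_hom_perturb module_hom_undeformed
        module_hom_psi assms(1) M.module_hom_id)
  ultimately show ?thesis
    unfolding fps_maps_perturb[OF \<delta>, abs_def] fps_maps_perturb[OF \<psi>, abs_def] twist_hom_def
      fps_data_simps fps_maps_undeformed fps_lift_id
    using assms(2)
    by (simp add: fps_times_bilin mult.fps_bilin_perturb[OF \<delta>] lact.fps_bilin_perturb[OF \<psi>]
        ract.fps_bilin_perturb[OF \<psi>] cochain.fps_bilin_perturb[OF \<psi>] nijenhuis_def algebra_simps)
qed

section \<open>Eliminating the leading coefficient\<close>

lemma leading_coeff_Z1: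
  assumes "formal_deformation D T S" and "0 < n"
    and sparse: "\<And>i. 0 < i \<Longrightarrow> i < n \<Longrightarrow> S i = (\<lambda>u. 0)"
  shows "S n \<in> Z1 D T"
proof -
  have lin: "\<And>i. module_hom (scaleM D) (scaleA D) (S i)"
    and S0 [simp]: "S 0 = T"
    and rb: "twisted_rota_baxter (fps_data D) (fps_maps S)"
    using assms(1) by (auto simp: formal_deformation_def)
  interpret S: additive "S i" for i by (rule module_hom_additive[OF lin])
  have "d1 D T (S n) u v = 0" for u v
  proof -
    \<comment> \<open>Testing on constant series is enough: there the coefficient of t^i of the
      deformed operator is just \<open>S i\<close> of the constant.\<close>
    let ?u = "fps_const u" and ?v = "fps_const v"
    have nth: "fps_nth (fps_maps S (fps_const w)) i = S i w" for i w
    proof -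
      have "fps_nth (fps_maps S (fps_const w)) i = (\<Sum>j\<in>{i}. S j (fps_nth (fps_const w) (i - j)))"
        unfolding fps_maps_nth by (rule sum.mono_neutral_right) (auto simp: S.zero)
      then show ?thesis by simp
    qed
    \<comment> \<open>\<open>?W\<close> is the argument of the operator on the right of the
      Rota-Baxter identity. By sparseness only its coefficients 0 and \<open>n\<close> contribute in
      degree \<open>n\<close>.\<close>
    let ?W = "fps_bilin (ract D) ?u (fps_maps S ?v) + fps_bilin (lact D) (fps_maps S ?u) ?v
      + fps_bilin (cochain D) (fps_maps S ?u) (fps_maps S ?v)"
    have W0: "fps_nth ?W 0 = u \<lhd> T v + T u \<rhd> v + H (T u) (T v)"
      by (simp add: fps_bilin_nth nth)
    have Wn: "fps_nth ?W n = u \<lhd> S n v + S n u \<rhd> v + (H (T u) (S n v) + H (S n u) (T v))"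
      using \<open>0 < n\<close> by (simp add: fps_bilin_nth_sparse nth sparse ract.left.zero ract.right.zero
          lact.left.zero lact.right.zero cochain.left.zero)
    have "fps_nth (fps_maps S ?u * fps_maps S ?v) n = fps_nth (fps_maps S ?W) n"
      using rb by (simp add: twisted_rota_baxter_def)
    also have "fps_nth (fps_maps S ?u * fps_maps S ?v) n = T u * S n v + S n u * T v"
      using \<open>0 < n\<close> by (simp add: fps_times_bilin fps_bilin_nth_sparse nth sparse)
    also have "fps_nth (fps_maps S ?W) n = T (fps_nth ?W n) + S n (fps_nth ?W 0)"
    proof -
      have "fps_nth (fps_maps S ?W) n = (\<Sum>i\<in>{0,n}. S i (fps_nth ?W (n - i)))"
        unfolding fps_maps_nth using sparse by (intro sum.mono_neutral_right) auto
      then show ?thesis using \<open>0 < n\<close> by simp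
    qed
    finally show ?thesis
      using S.add[of 0] S.add[of n] unfolding W0 Wn by (simp add: d1_def algebra_simps)
  qed
  with lin show ?thesis by (simp add: Z1_def)
qed

text \<open>One round of elimination. For \<open>n = 1\<close> the sparseness assumption is vacuous,
  so the process can start from any deformation.\<close>

lemma deformation_step:
  assumes Z1: "Z1 D T = d0 D T ` Nij D T"
    and S: "formal_deformation D T S"
    and "0 < n" and sparse: "\<And>i. 0 < i \<Longrightarrow> i < n \<Longrightarrow> S i = (\<lambda>u. 0)"
  obtains a S' where "nijenhuis D T a" and "formal_deformation D T S'"
    and "\<And>i. 0 < i \<Longrightarrow> i \<le> n \<Longrightarrow> S' i = (\<lambda>u. 0)"
    and "rb_morphism (fps_data D) (fps_maps S) (fps_maps S')
      (\<lambda>x. x + fps_delay n (fps_lift (\<lambda>b. a * b - b * a) x))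
      (\<lambda>u. u + fps_delay n (fps_lift (psi D T a) u))"
proof -
  have lin: "\<And>i. module_hom (scaleM D) (scaleA D) (S i)"
    and S0 [simp]: "S 0 = T"
    and rb: "twisted_rota_baxter (fps_data D) (fps_maps S)"
    using S by (auto simp: formal_deformation_def)
  have T: "module_hom (scaleM D) (scaleA D) T" using lin[of 0] by simp
  interpret T: additive T by (rule module_hom_additive[OF T])
  obtain a where a: "nijenhuis D T a" and Sn: "S n = d0 D T a"
    using leading_coeff_Z1[OF S \<open>0 < n\<close> sparse] Z1 by (auto simp: Nij_def)
  let ?\<delta> = "\<lambda>b. a * b - b * a" and ?\<psi> = "psi D T a"
  have \<delta>: "additive ?\<delta>" and \<psi>: "additive ?\<psi>"
    using module_hom_additive module_hom_commutator module_hom_psi[OF T] by blast+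
  \<comment> \<open>\<open>S' = \<phi> S \<psi>\<^sup>-\<^sup>1\<close>, by solving \<open>S' \<psi> = \<phi> S\<close> coefficientwise\<close>
  define S' where "S' = delay_rec (n - 1) S
    (\<lambda>m z u. perturb n ?\<delta> S m u - z (?\<psi> u))"
  have S'_low: "S' m = S m" if "m < n" for m
    using that by (simp add: S'_def delay_rec.simps)
  have S'_high: "S' m = (\<lambda>u. perturb n ?\<delta> S m u - (S' (m - n) \<circ> ?\<psi>) u)" if "n \<le> m" for m
    using that \<open>0 < n\<close> by (simp add: S'_def delay_rec.simps[of _ _ _ m])
  have lin': "module_hom (scaleM D) (scaleA D) (S' m)" for m
  proof (induction m rule: less_induct)
    case (less m)
    interpret module_pair "scaleM D" "scaleA D" by unfold_locales
    show ?case
    proof (cases "m < n")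
      case True
      then show ?thesis by (simp add: S'_low lin)
    next
      case False
      then show ?thesis
        using module_hom_compose[OF module_hom_psi[OF T] less[of "m - n"]] \<open>0 < n\<close>
        unfolding S'_high[OF leI[OF False]]
        by (intro module_hom_sub module_hom_perturb module_hom_commutator lin) (auto simp: comp_def)
    qed
  qed
  interpret S': additive "S' i" for i by (rule module_hom_additive[OF lin'])
  have intertwine: "fps_maps S u + fps_delay n (fps_lift ?\<delta> (fps_maps S u))
      = fps_maps S' (u + fps_delay n (fps_lift ?\<psi> u))" for u
  proof -
    have "fps_maps S' (u + fps_delay n (fps_lift ?\<psi> u))
        = fps_maps S' u + fps_delay n (fps_maps (\<lambda>m u. S' m (?\<psi> u)) u)"
      by (simp add: fps_maps_add S'.additive_axioms fps_maps_delay_right S'.zero)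
        (simp add: fps_eq_iff fps_maps_nth)
    \<comment> \<open>In degree m \<ge> n the recursion says S'_m + S'_(m-n) \<psi> = S_m + \<delta>
      S_(m-n), with \<delta> the commutator with a; below n both sides are S_m.\<close>
    also have "\<dots> = fps_maps (perturb n ?\<delta> S) u"
      unfolding fps_maps_delay_left[symmetric]
      by (auto simp: fps_eq_iff fps_maps_nth S'_low S'_high perturb_def not_less
          simp flip: sum.distrib intro!: sum.cong)
    finally show ?thesis by (simp add: fps_maps_perturb[OF \<delta>])
  qed
  have mor: "rb_morphism (fps_data D) (fps_maps S) (fps_maps S')
      (\<lambda>x. x + fps_delay n (fps_lift ?\<delta> x)) (\<lambda>u. u + fps_delay n (fps_lift ?\<psi> u))"
    using fps_maps_module_hom[OF lin'] intertwine
    by (intro rb_morphism_transport rb twist_hom_perturb T a surj_perturb \<open>0 < n\<close>) simp_all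
  moreover from mor have "formal_deformation D T S'"
    using lin' S'_low[OF \<open>0 < n\<close>] by (simp add: formal_deformation_def rb_morphism_iff)
  moreover have "S' i = (\<lambda>u. 0)" if "0 < i" "i \<le> n" for i
  proof (cases "i = n")
    \<comment> \<open>Here S'_n = S_n + \<delta> T - T \<psi>, while \<open>d0 D T a\<close> equals
      T \<psi> - \<delta> T, so everything cancels.\<close>
    case True
    with \<open>0 < n\<close> show ?thesis
      by (simp add: S'_high S'_low perturb_def Sn d0_def psi_def T.add T.diff)
  qed (use that sparse S'_low in auto)
  ultimately show ?thesis using that a by blast
qed

section \<open>Iterating the elimination and passing to the limit\<close>

text \<open>\<open>T\<close> acts coefficientwise, so each coefficient of the identity over power
  series is a sum of instances of the identity for \<open>T\<close>.\<close>

lemma undeformed_formal_deformation: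
  assumes "twisted_rota_baxter D T"
  shows "formal_deformation D T (undeformed T)"
proof -
  have T: "module_hom (scaleM D) (scaleA D) T"
    and rb: "T u * T v = T (u \<lhd> T v + T u \<rhd> v + H (T u) (T v))" for u v
    using assms by (auto simp: twisted_rota_baxter_def)
  interpret T: additive T by (rule module_hom_additive[OF T])
  have "module_hom (fps_bilin (scaleM D)) (fps_bilin (scaleA D)) (fps_maps (undeformed T))"
    by (intro fps_maps_module_hom module_hom_undeformed T)
  moreover have "fps_lift T u * fps_lift T v = fps_lift T (fps_bilin (ract D) u (fps_lift T v)
      + fps_bilin (lact D) (fps_lift T u) v + fps_bilin (cochain D) (fps_lift T u) (fps_lift T v))"
    for u v
    by (simp add: fps_eq_iff fps_mult_nth fps_bilin_nth rb T.sum flip: sum.distrib)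
  ultimately show ?thesis
    by (simp add: formal_deformation_def module_hom_undeformed T twisted_rota_baxter_def)
qed

lemma deformation_equivalent_undeformed:
  assumes T: "twisted_rota_baxter D T"
    and Z1: "Z1 D T = d0 D T ` Nij D T"
    and Tt: "formal_deformation D T Tt"
  shows "equivalent_deformations D T Tt (undeformed T)"
proof -
  have lin: "module_hom (scaleM D) (scaleA D) T"
    using T by (simp add: twisted_rota_baxter_def)
  note \<delta> = module_hom_commutator and \<psi> = module_hom_psi[OF lin]
  note perturb = fps_maps_perturb[OF module_hom_additive[OF \<delta>], abs_def]
    fps_maps_perturb[OF module_hom_additive[OF \<psi>], abs_def]
  \<comment> \<open>A state holds the current deformation \<open>S\<close> and the accumulated
    morphism \<open>(F, G)\<close> from \<open>Tt\<close> to it. Stage \<open>k\<close> has killed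
    degrees 1 to \<open>k + 1\<close>; thus stage 0 has already done the step \<open>n = 1\<close>,
    which fixes the element \<open>a\<close> of the linear coefficients.\<close>
  define P where "P k X \<longleftrightarrow> (case X of (S, F, G) \<Rightarrow>
    formal_deformation D T S \<and> (\<forall>i. 0 < i \<longrightarrow> i \<le> Suc k \<longrightarrow> S i = (\<lambda>u. 0)) \<and>
    (\<forall>i. module_hom (scaleA D) (scaleA D) (F i)) \<and> (\<forall>i. module_hom (scaleM D) (scaleM D) (G i)) \<and>
    rb_morphism (fps_data D) (fps_maps Tt) (fps_maps S) (fps_maps F) (fps_maps G) \<and>
    F 0 = id \<and> G 0 = id \<and> (\<exists>a. F 1 = (\<lambda>b. a * b - b * a) \<and> G 1 = psi D T a))" for k X
  \<comment> \<open>Agreement of consecutive stages up to degree \<open>k + 1\<close>, which yields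
    convergence.\<close>
  define Q where "Q k X Y \<longleftrightarrow> (case X of (S, F, G) \<Rightarrow> case Y of (S', F', G') \<Rightarrow>
    \<forall>i\<le>Suc k. F' i = F i \<and> G' i = G i)"
    for k :: nat and X Y :: "(nat \<Rightarrow> 'm \<Rightarrow> 'a) \<times> (nat \<Rightarrow> 'a \<Rightarrow> 'a) \<times> (nat \<Rightarrow> 'm \<Rightarrow> 'm)"
  have "\<exists>X. \<forall>k. P k (X k) \<and> Q k (X k) (X (Suc k))"
  proof (rule dependent_nat_choice)
    obtain a S where a: "formal_deformation D T S" "\<And>i. 0 < i \<Longrightarrow> i \<le> 1 \<Longrightarrow> S i = (\<lambda>u. 0)"
        "rb_morphism (fps_data D) (fps_maps Tt) (fps_maps S)
          (\<lambda>x. x + fps_delay 1 (fps_lift (\<lambda>b. a * b - b * a) x))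
          (\<lambda>u. u + fps_delay 1 (fps_lift (psi D T a) u))"
      by (rule deformation_step[OF Z1 Tt, of 1]) auto
    let ?F = "perturb 1 (\<lambda>b. a * b - b * a) (undeformed id)"
      and ?G = "perturb 1 (psi D T a) (undeformed id)"
    have "module_hom (scaleA D) (scaleA D) (?F i)" "module_hom (scaleM D) (scaleM D) (?G i)" for i
      by (intro module_hom_perturb module_hom_undeformed \<delta> \<psi> A.module_hom_id M.module_hom_id)+
    moreover have "?F 0 = id" "?G 0 = id" "?F 1 = (\<lambda>b. a * b - b * a)" "?G 1 = psi D T a"
      by (simp_all add: perturb_def undeformed_def fun_eq_iff)
    moreover have "rb_morphism (fps_data D) (fps_maps Tt) (fps_maps S) (fps_maps ?F) (fps_maps ?G)"
      using a(3) unfolding perturb fps_maps_undeformed fps_lift_id .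
    ultimately have "P 0 (S, ?F, ?G)"
      unfolding P_def prod.case using a(1,2) by (metis One_nat_def)
    then show "\<exists>X. P 0 X" ..
  next
    fix X k
    assume "P k X"
    obtain S F G where X: "X = (S, F, G)" by (cases X)
    let ?n = "Suc (Suc k)"
    have S: "formal_deformation D T S" "\<And>i. 0 < i \<Longrightarrow> i < ?n \<Longrightarrow> S i = (\<lambda>u. 0)"
      and F: "\<And>i. module_hom (scaleA D) (scaleA D) (F i)"
      and G: "\<And>i. module_hom (scaleM D) (scaleM D) (G i)"
      and mor: "rb_morphism (fps_data D) (fps_maps Tt) (fps_maps S) (fps_maps F) (fps_maps G)"
      and low: "F 0 = id" "G 0 = id" "\<exists>a. F 1 = (\<lambda>b. a * b - b * a) \<and> G 1 = psi D T a"
      using \<open>P k X\<close> by (auto simp: P_def X)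
    obtain a S' where a: "formal_deformation D T S'" "\<And>i. 0 < i \<Longrightarrow> i \<le> ?n \<Longrightarrow> S' i = (\<lambda>u. 0)"
        "rb_morphism (fps_data D) (fps_maps S) (fps_maps S')
          (\<lambda>x. x + fps_delay ?n (fps_lift (\<lambda>b. a * b - b * a) x))
          (\<lambda>u. u + fps_delay ?n (fps_lift (psi D T a) u))"
      by (rule deformation_step[OF Z1 S(1) _ S(2)]) auto
    let ?F = "perturb ?n (\<lambda>b. a * b - b * a) F" and ?G = "perturb ?n (psi D T a) G"
    \<comment> \<open>The new factor changes nothing below degree \<open>k + 2\<close>. Hence the
      linear coefficients survive, although each round uses its own Nijenhuis element.\<close>
    have same: "?F i = F i" "?G i = G i" if "i \<le> Suc k" for i
      using that by (auto simp: perturb_def)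
    have "module_hom (scaleA D) (scaleA D) (?F i)" "module_hom (scaleM D) (scaleM D) (?G i)" for i
      by (intro module_hom_perturb \<delta> \<psi> F G)+
    \<comment> \<open>The composite with the new automorphism is rewritten as one formal
      sum.\<close>
    moreover have "rb_morphism (fps_data D) (fps_maps Tt) (fps_maps S') (fps_maps ?F) (fps_maps ?G)"
      using rb_morphism_comp[OF mor a(3)] unfolding perturb comp_def .
    ultimately have "P (Suc k) (S', ?F, ?G)"
      unfolding P_def prod.case using a(1,2) low by (simp add: same)
    moreover have "Q k X (S', ?F, ?G)"
      by (auto simp: Q_def X same)
    ultimately show "\<exists>Y. P (Suc k) Y \<and> Q k X Y" by blast
  qed
  then obtain X where X: "P k (X k)" "Q k (X k) (X (Suc k))" for k by blast
  define R F G where "R k = fst (X k)" and "F k = fst (snd (X k))" and "G k = snd (snd (X k))" for k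
  have P: "P k (R k, F k, G k)" for k
    using X(1)[of k] by (simp add: R_def F_def G_def)
  have Suc: "F (Suc k) i = F k i" "G (Suc k) i = G k i" if "i \<le> Suc k" for k i
    using X(2)[of k] that by (auto simp: Q_def F_def G_def split: prod.splits)
  have stable: "F (i + d) i = F i i \<and> G (i + d) i = G i i" for i d
    by (induction d) (simp_all add: Suc)
  \<comment> \<open>The limit is the diagonal: coefficient \<open>i\<close> is stationary from stage
    \<open>i\<close> on.\<close>
  define \<Phi> \<Psi> where "\<Phi> i = F i i" and "\<Psi> i = G i i" for i
  have F_eq: "F k i = \<Phi> i" and G_eq: "G k i = \<Psi> i" if "i \<le> k" for k i
    using stable[of i "k - i"] that by (auto simp: \<Phi>_def \<Psi>_def)
  have \<Phi>: "module_hom (scaleA D) (scaleA D) (\<Phi> i)"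
    and \<Psi>: "module_hom (scaleM D) (scaleM D) (\<Psi> i)" for i
    using P[of i] by (auto simp: P_def \<Phi>_def \<Psi>_def)
  \<comment> \<open>Stage \<open>k\<close> has constant term \<open>T\<close> and vanishes in
    degrees 1 to \<open>k + 1\<close>, so the operators converge to the undeformed one.\<close>
  have R_eq: "R k i = undeformed T i" if "i \<le> k" for k i
    using P[of k] that by (auto simp: P_def undeformed_def formal_deformation_def)
  have und: "formal_deformation D T (undeformed T)"
    by (rule undeformed_formal_deformation[OF T])
  have "rb_morphism (fps_data D) (fps_maps Tt) (fps_maps (undeformed T)) (fps_maps \<Phi>) (fps_maps \<Psi>)"
    using P und by (intro rb_morphism_limit[OF _ F_eq G_eq R_eq] \<Phi> \<Psi>)
      (simp_all add: P_def formal_deformation_def)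
  moreover have "\<exists>a. \<Phi> 1 = (\<lambda>b. a * b - b * a) \<and> \<Psi> 1 = psi D T a"
    using P[of 1] by (simp add: P_def \<Phi>_def \<Psi>_def)
  moreover have "\<Phi> 0 = id" "\<Psi> 0 = id"
    using P[of 0] by (simp_all add: P_def \<Phi>_def \<Psi>_def)
  ultimately show ?thesis
    unfolding equivalent_deformations_def using Tt und \<Phi> \<Psi> by blast
qed

end

theorem theorem4p7:
  fixes D :: "('k::field_char_0, 'a::ring, 'm::ab_group_add) twist_data"
    and T :: "'m \<Rightarrow> 'a"
    and Tt :: "nat \<Rightarrow> 'm \<Rightarrow> 'a"
  assumes "assoc_algebra D" and "bimodule D" and "hochschild_2cocycle D"
    and "twisted_rota_baxter D T"
    and "Z1 D T = d0 D T ` Nij D T"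
    and "formal_deformation D T Tt"
  shows "equivalent_deformations D T Tt (undeformed T)"
proof -
  interpret hochschild_twist D
    using assms(1-3) by unfold_locales
  show ?thesis
    using assms(4-6) by (rule deformation_equivalent_undeformed)
qed

end
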